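(* Assume that the strictly positive gap condition holds and that the window $w$ is even and regular. Let $(f_0,g_0)$ and $(f_1,g_1)$ be two pairs of non-decreasing profiles in $\mathcal{S}_f\times\mathcal{S}_g$, both of which are fixed points, i.e. for $i=0,1$ and all $x\in\mathbb{R}$ $$g_i(x)=h_g\big((f_i\otimes w)(x)\big),\qquad f_i(x)=h_f\big((g_i\otimes w)(x)\big).$$ Then the two pairs are translates of each other: there is a constant $c\in\mathbb{R}$ such that $f_1(x)=f_0(x-c)$ and $g_1(x)=g_0(x-c)$ for all $x\in\mathbb{R}$; i.e. $y-T_f(y)$ is constant $\mathrm{d}f_0$-almost everywhere and $x-T_g(x)$ takes the same constant value $\mathrm{d}g_0$-almost everywhere.
   Context: Window. $w:\mathbb{R}\to\mathbb{R}$ is bounded, non-negative, even, integrable, with $\int_{\mathbb{R}}w(x)\,dx=1$; $\otimes$ denotes convolution on $\mathbb{R}$. Regular means: there is $W\in(0,+\infty]$ such that $w$ is strictly positive on $(-W,W)$ and $0$ outside $[-W,W]$. Update functions. $h_f,h_g:[0,1]\to[0,1]$ are non-decreasing with $h_f(0)=h_g(0)=0$ and $h_f(1)=h_g(1)=1$. The inverse $h_g^{-1}$ is understood as a (generalized) inverse, e.g. $h_g^{-1}(u)=\sup\{v\in[0,1]: h_g(v)\le u\}$. Strictly positive gap condition. With $A(h_f,h_g;u)=\int_0^u\big(h_g^{-1}(u')-h_f(u')\big)\,du'$, the condition is: $A(h_f,h_g;u)>0$ for all $u\in\,]0,1[$ and $A(h_f,h_g;1)=0$. Profile spaces. Fix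 $\epsilon>0$. $\mathcal{S}_f=\mathcal{S}_g$ is the set of measurable functions $p:\mathbb{R}\to[0,1]$ with $\lim_{x\to-\infty}|x|^{1+\epsilon}p(x)=0$ and $\lim_{x\to+\infty}x^{1+\epsilon}(p(x)-1)=0$. For a non-decreasing profile $p$, $\mathrm{d}p$ denotes the associated Lebesgue–Stieltjes probability measure. The maps are $T_f(x)=f_1^{-1}(f_0(x))$ and $T_g(x)=g_1^{-1}(g_0(x))$, where right-continuous versions of the profiles are used and $p^{-1}(u)=\inf\{x: p(x)\ge u\}$. *)

theory Defs
  imports "HOL-Analysis.Analysis"
begin

definition window :: "(real \<Rightarrow> real) \<Rightarrow> bool" where
  "window w \<longleftrightarrow> bounded (range w) \<and> (\<forall>x. 0 \<le> w x) \<and> (\<forall>x. w (- x) = w x)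
     \<and> integrable lborel w \<and> (LBINT x. w x) = 1"

definition regular_window :: "(real \<Rightarrow> real) \<Rightarrow> bool" where
  "regular_window w \<longleftrightarrow> (\<exists>W::ereal. 0 < W
     \<and> (\<forall>x. ereal \<bar>x\<bar> < W \<longrightarrow> 0 < w x)
     \<and> (\<forall>x. W < ereal \<bar>x\<bar> \<longrightarrow> w x = 0))"

definition conv :: "(real \<Rightarrow> real) \<Rightarrow> (real \<Rightarrow> real) \<Rightarrow> real \<Rightarrow> real" where
  "conv p w x = (LBINT y. p y * w (x - y))"

text \<open>Update functions are functions on the unit interval; their values elsewhere are
  irrelevant.\<close>

definition update_fun :: "(real \<Rightarrow> real) \<Rightarrow> bool" where
  "update_fun h \<longleftrightarrow> h \<in> {0..1} \<rightarrow> {0..1} \<and> mono_on {0..1} h \<and> h 0 = 0 \<and> h 1 = 1"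

definition update_inv :: "(real \<Rightarrow> real) \<Rightarrow> real \<Rightarrow> real" where
  "update_inv h u = Sup {v \<in> {0..1}. h v \<le> u}"

definition gap :: "(real \<Rightarrow> real) \<Rightarrow> (real \<Rightarrow> real) \<Rightarrow> real \<Rightarrow> real" where
  "gap hf hg u = (LBINT v:{0..u}. update_inv hg v - hf v)"

definition strictly_positive_gap :: "(real \<Rightarrow> real) \<Rightarrow> (real \<Rightarrow> real) \<Rightarrow> bool" where
  "strictly_positive_gap hf hg \<longleftrightarrow> (\<forall>u \<in> {0<..<1}. 0 < gap hf hg u) \<and> gap hf hg 1 = 0"

definition profiles :: "real \<Rightarrow> (real \<Rightarrow> real) set" where
  "profiles \<epsilon> = {p \<in> borel_measurable borel. range p \<subseteq> {0..1}
     \<and> ((\<lambda>x. \<bar>x\<bar> powr (1 + \<epsilon>) * p x) \<longlongrightarrow> 0) at_bot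
     \<and> ((\<lambda>x. x powr (1 + \<epsilon>) * (p x - 1)) \<longlongrightarrow> 0) at_top}"

definition right_cont :: "(real \<Rightarrow> real) \<Rightarrow> real \<Rightarrow> real" where
  "right_cont p x = Lim (at_right x) p"

definition profile_measure :: "(real \<Rightarrow> real) \<Rightarrow> real measure" where
  "profile_measure p = interval_measure (right_cont p)"

text \<open>The infimum is taken in the reals, so the value is meaningful only for levels \<open>u\<close>
  where the set is nonempty and bounded below.\<close>

definition profile_inv :: "(real \<Rightarrow> real) \<Rightarrow> real \<Rightarrow> real" where
  "profile_inv p u = Inf {x. u \<le> p x}"

definition transport :: "(real \<Rightarrow> real) \<Rightarrow> (real \<Rightarrow> real) \<Rightarrow> real \<Rightarrow> real" where
  "transport p q x = profile_inv (right_cont q) (right_cont p x)"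

definition fixed_point ::
  "(real \<Rightarrow> real) \<Rightarrow> (real \<Rightarrow> real) \<Rightarrow> (real \<Rightarrow> real) \<Rightarrow> (real \<Rightarrow> real) \<Rightarrow> (real \<Rightarrow> real) \<Rightarrow> bool" where
  "fixed_point hf hg w f g \<longleftrightarrow>
     (\<forall>x. g x = hg (conv f w x)) \<and> (\<forall>x. f x = hf (conv g w x))"

end

theory Submission
  imports Defs
begin

text \<open>Let \<open>X\<^sub>i\<close>, \<open>Y\<^sub>i\<close> on \<open>(0,1)\<close> be the quantile functions of \<open>f\<^sub>i\<close>, \<open>g\<^sub>i\<close> and let \<open>\<Omega>\<close> be the
  primitive of \<open>w\<close>. The fixed point equations say that \<open>\<integral> \<Omega>(Y\<^sub>i(v) - X\<^sub>i(u)) du\<close> and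
  \<open>\<integral> \<Omega>(Y\<^sub>i(v) - X\<^sub>i(u)) dv\<close> are determined by \<open>hg\<close> at \<open>v\<close> and by \<open>hf\<close> at \<open>u\<close>, hence do not depend on
  \<open>i\<close>. Testing the difference for \<open>i = 0, 1\<close> against \<open>(Y\<^sub>1 - Y\<^sub>0)(v) - (X\<^sub>1 - X\<^sub>0)(u)\<close>, which is
  integrable by the decay of the profiles, gives zero, although the integrand is nonnegative because
  \<open>\<Omega>\<close> is monotone. So \<open>\<Omega>(Y\<^sub>1(v) - X\<^sub>1(u)) = \<Omega>(Y\<^sub>0(v) - X\<^sub>0(u))\<close> for all \<open>u, v\<close>, and since \<open>\<Omega>\<close> is injective
  where it is not \<open>0\<close> or \<open>1\<close>, \<open>Y\<^sub>1 - Y\<^sub>0\<close> at \<open>v\<close> equals \<open>X\<^sub>1 - X\<^sub>0\<close> at \<open>u\<close> for interacting levels.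
  If \<open>Y\<^sub>1 - Y\<^sub>0\<close> were not constant, the levels would split into non-interacting parts, and the
  lower part would be a wave of its own, which forces a nonpositive gap.\<close>

section \<open>Cumulative window and the unit interval\<close>

text \<open>The \<Omega> of the overview: the distribution function of the probability density
  \<open>w\<close>.\<close>

definition cumulative :: "(real \<Rightarrow> real) \<Rightarrow> real \<Rightarrow> real" where
  "cumulative w x = (LBINT y:{..x}. w y)"

lemma window_set_integrable:
  assumes "window w" "A \<in> sets lborel"
  shows "set_integrable lborel A w"
  using assms integrable_mult_indicator[of A lborel w] by (simp add: window_def set_integrable_def)

lemma cumulative_diff:
  assumes w: "window w" and "a \<le> b"
  shows "cumulative w b - cumulative w a = (LBINT y:{a<..b}. w y)"
proof -
  have "{..b} = {..a} \<union> {a<..b}" using \<open>a \<le> b\<close> by auto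
  then have "cumulative w b = (LBINT y:{..a} \<union> {a<..b}. w y)"
    by (simp add: cumulative_def)
  also have "\<dots> = (LBINT y:{..a}. w y) + (LBINT y:{a<..b}. w y)"
    by (rule set_integral_Un) (auto intro: window_set_integrable[OF w])
  finally show ?thesis by (simp add: cumulative_def)
qed

lemma window_set_integral_nonneg:
  assumes "window w" shows "0 \<le> (LBINT y:A. w y)"
  using assms unfolding window_def set_lebesgue_integral_def
  by (intro Bochner_Integration.integral_nonneg) auto

lemma cumulative_mono:
  assumes w: "window w" and "a \<le> b"
  shows "cumulative w a \<le> cumulative w b"
  using cumulative_diff[OF assms] window_set_integral_nonneg[OF w, of "{a<..b}"] by simp

lemma cumulative_nonneg: "window w \<Longrightarrow> 0 \<le> cumulative w x"
  unfolding cumulative_def by (rule window_set_integral_nonneg)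

text \<open>Evenness of \<open>w\<close> turns the left tail at \<open>- x\<close> into the right
  tail at \<open>x\<close>, which complements \<open>{..x}\<close> up to one point.\<close>

lemma cumulative_minus:
  assumes w: "window w"
  shows "cumulative w (- x) = 1 - cumulative w x"
proof -
  have int: "integrable lborel w" and one: "(LBINT x. w x) = 1" and even: "w (- y) = w y" for y
    using w by (auto simp: window_def)
  have "cumulative w (- x) = (LBINT y. indicator {..- x} y * w y)"
    by (simp add: cumulative_def set_lebesgue_integral_def)
  also have "\<dots> = (LBINT y. indicator {..- x} (- y) * w y)"
    using lborel_integral_real_affine[of "-1" "\<lambda>y. indicator {..- x} y * w y" 0] even by simp
  also have "\<dots> = (LBINT y. indicator {x..} y * w y)"
    by (intro Bochner_Integration.integral_cong) (auto simp: indicator_def)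
  also have "\<dots> = (LBINT y. w y - indicator {..x} y * w y)"
  proof (rule integral_cong_AE)
    have "AE y in lborel. y \<noteq> x" by (rule AE_lborel_singleton)
    then show "AE y in lborel. indicator {x..} y * w y = w y - indicator {..x} y * w y"
      by eventually_elim (auto simp: indicator_def)
  qed (use int in auto)
  also have "\<dots> = 1 - cumulative w x"
    using window_set_integrable[OF w, of "{..x}"] int one
    by (simp add: cumulative_def set_lebesgue_integral_def set_integrable_def)
  finally show ?thesis .
qed

lemma cumulative_le_1: "window w \<Longrightarrow> cumulative w x \<le> 1"
  using cumulative_minus[of w x] cumulative_nonneg[of w "-x"] by simp

text \<open>A bound for \<open>w\<close> is a Lipschitz constant of its primitive; convolutions
  inherit this constant in \<open>isCont_conv\<close>.\<close>

lemma lipschitz_cumulative: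
  assumes w: "window w"
  shows "\<exists>B. B-lipschitz_on UNIV (cumulative w)"
proof -
  obtain B where B: "\<And>x. \<bar>w x\<bar> \<le> B"
    using w unfolding window_def bounded_iff by (metis rangeI real_norm_def)
  then have B0: "0 \<le> B" using order_trans[OF abs_ge_zero] by blast
  have le: "\<bar>cumulative w b - cumulative w a\<bar> \<le> B * (b - a)" if "a \<le> b" for a b
  proof -
    have "(LBINT y:{a<..b}. w y) \<le> (LBINT y:{a<..b}. B)"
    proof (rule set_integral_mono)
      show "set_integrable lborel {a<..b} w" by (auto intro: window_set_integrable[OF w])
      show "set_integrable lborel {a<..b} (\<lambda>y. B)"
        unfolding set_integrable_def
        by (intro integrable_scaleR_left integrable_real_indicator) (auto simp: emeasure_lborel_Ioc that)
      show "w y \<le> B" for y using B[of y] by simp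
    qed
    also have "\<dots> = B * (b - a)" using that by (simp add: set_lebesgue_integral_def)
    finally show ?thesis
      using cumulative_diff[OF w that] window_set_integral_nonneg[OF w, of "{a<..b}"] by simp
  qed
  have "dist (cumulative w x) (cumulative w y) \<le> B * dist x y" for x y
    using le[of x y] le[of y x] by (cases "x \<le> y") (auto simp: dist_real_def abs_minus_commute)
  then have "B-lipschitz_on UNIV (cumulative w)"
    using B0 by (auto simp: lipschitz_on_def)
  then show ?thesis ..
qed

lemma isCont_cumulative: "window w \<Longrightarrow> isCont (cumulative w) x"
  using lipschitz_cumulative[of w] lipschitz_on_continuous_on continuous_on_eq_continuous_at open_UNIV
  by blast

text \<open>Regularity enters here. A value strictly between 0 and 1 places the argument in the open
  interval \<open>(-W, W)\<close>, where \<open>w\<close> is positive, so \<open>w\<close> has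
  positive integral between two distinct such points.\<close>

lemma cumulative_inj:
  assumes w: "window w" and "regular_window w"
    and pos: "0 < cumulative w a" and less: "cumulative w a < 1"
    and eq: "cumulative w a = cumulative w b"
  shows "a = b"
proof (rule ccontr)
  assume "a \<noteq> b"
  obtain W where W: "0 < W" "\<And>x. ereal \<bar>x\<bar> < W \<Longrightarrow> 0 < w x" "\<And>x. W < ereal \<bar>x\<bar> \<Longrightarrow> w x = 0"
    using \<open>regular_window w\<close> unfolding regular_window_def by blast
  have out: "cumulative w x = 0" if "x < 0" "W \<le> ereal \<bar>x\<bar>" for x
  proof -
    have "(LBINT y:{..x}. w y) = (LBINT y:{..x}. 0)"
      unfolding set_lebesgue_integral_def
    proof (rule integral_cong_AE)
      \<comment> \<open>At \<open>x = - W\<close> the value of \<open>w\<close> is unspecified, but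
        a single point is null.\<close>
      have "AE y in lborel. y \<noteq> x" by (rule AE_lborel_singleton)
      then show "AE y in lborel. indicator {..x} y *\<^sub>R w y = indicator {..x} y *\<^sub>R 0"
      proof eventually_elim
        case (elim y)
        have "w y = 0" if "y \<le> x"
          by (rule W(3), rule le_less_trans[OF \<open>W \<le> ereal \<bar>x\<bar>\<close>]) (use that elim \<open>x < 0\<close> in simp)
        then show ?case by (auto simp: indicator_def)
      qed
    qed (use window_set_integrable[OF w, of "{..x}"] in \<open>auto simp: set_integrable_def\<close>)
    then show ?thesis by (simp add: cumulative_def)
  qed
  have inside: "ereal \<bar>x\<bar> < W" if "0 < cumulative w x" "cumulative w x < 1" for x
  proof (rule ccontr)
    assume "\<not> ereal \<bar>x\<bar> < W"
    then have "W \<le> ereal \<bar>x\<bar>" "x \<noteq> 0" using W(1) by (auto simp: zero_ereal_def)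
    then show False
    proof (cases "x < 0")
      case True
      then show ?thesis using out[OF True \<open>W \<le> ereal \<bar>x\<bar>\<close>] that by simp
    next
      case False
      then have "cumulative w (- x) = 0" using \<open>W \<le> ereal \<bar>x\<bar>\<close> \<open>x \<noteq> 0\<close> by (intro out) simp_all
      then show ?thesis using cumulative_minus[OF w, of x] that by simp
    qed
  qed
  have contra: False
    if "x < y" and cx: "0 < cumulative w x" "cumulative w x < 1" and c: "cumulative w x = cumulative w y"
    for x y
  proof -
    have ex: "ereal \<bar>x\<bar> < W" "ereal \<bar>y\<bar> < W" using inside that by auto
    have "0 < w z" if "z \<in> {x<..y}" for z
    proof (rule W(2))
      have "\<bar>z\<bar> \<le> max \<bar>x\<bar> \<bar>y\<bar>" using that by auto
      then have "ereal \<bar>z\<bar> \<le> max (ereal \<bar>x\<bar>) (ereal \<bar>y\<bar>)" by (auto simp: max_def)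
      then show "ereal \<bar>z\<bar> < W" using ex by (simp add: le_less_trans)
    qed
    then have pos: "indicator {x<..y} z *\<^sub>R w z = 0 \<longleftrightarrow> z \<notin> {x<..y}" for z
      by (cases "z \<in> {x<..y}") (auto simp: less_le)
    have "(LBINT z. indicator {x<..y} z *\<^sub>R w z) = 0"
      using cumulative_diff[OF w, of x y] \<open>x < y\<close> c by (simp add: set_lebesgue_integral_def)
    then have "AE z in lborel. indicator {x<..y} z *\<^sub>R w z = 0"
      using w window_set_integrable[OF w, of "{x<..y}"]
      by (subst (asm) integral_nonneg_eq_0_iff_AE) (auto simp: set_integrable_def window_def)
    then have "AE z in lborel. z \<notin> {x<..y}" unfolding pos .
    then have "emeasure lborel {x<..y} = 0"
      by (subst (asm) AE_iff_measurable[of "{x<..y}"]) auto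
    then show False using \<open>x < y\<close> by (simp add: ennreal_eq_0_iff)
  qed
  from \<open>a \<noteq> b\<close> consider "a < b" | "b < a" by linarith
  then show False
  proof cases
    case 1
    then show ?thesis using pos less eq by (rule contra)
  next
    case 2
    then show ?thesis using pos less eq by (intro contra[of b a]) simp_all
  qed
qed

text \<open>Superlevel sets of a non-decreasing profile are half-lines, so this is the contribution
  of one level in \<open>conv_eq\<close>.\<close>

lemma window_tail_integral:
  assumes w: "window w"
  shows "(LBINT y. indicator {c..} y * w (x - y)) = cumulative w (x - c)"
proof -
  have "cumulative w (x - c) = (LBINT y. indicator {..x - c} y * w y)"
    by (simp add: cumulative_def set_lebesgue_integral_def)
  also have "\<dots> = (LBINT y. indicator {..x - c} (x - y) * w (x - y))"
    using lborel_integral_real_affine[of "-1" "\<lambda>y. indicator {..x - c} y * w y" x] by simp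
  also have "\<dots> = (LBINT y. indicator {c..} y * w (x - y))"
    by (intro Bochner_Integration.integral_cong) (auto simp: indicator_def)
  finally show ?thesis ..
qed

lemma measurable_cumulative: "window w \<Longrightarrow> cumulative w \<in> borel_measurable borel"
  by (intro borel_measurable_continuous_onI continuous_at_imp_continuous_on) (auto intro: isCont_cumulative)

section \<open>The open unit interval as the space of levels\<close>

definition unit_measure :: "real measure" where
  "unit_measure = restrict_space lborel {0<..<1}"

lemma space_unit_measure [simp]: "space unit_measure = {0<..<1}"
  by (simp add: unit_measure_def space_restrict_space)

lemma sets_unit_measure [measurable_cong]: "sets unit_measure = sets (restrict_space borel {0<..<1})"
  by (simp add: unit_measure_def sets_restrict_space)

lemma prob_emeasure_unit: "emeasure unit_measure (space unit_measure) = 1"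
  by (simp add: unit_measure_def emeasure_restrict_space space_restrict_space)

interpretation unit: finite_measure unit_measure
  by standard (use prob_emeasure_unit in simp)

interpretation unit_pair: pair_sigma_finite unit_measure unit_measure ..

interpretation lborel_unit: pair_sigma_finite lborel unit_measure ..

text \<open>Serves to write a number as an integral over levels, for the layer-cake formula in
  \<open>conv_eq\<close> and the area comparison in \<open>gap_nonpos\<close>.\<close>

lemma integral_unit_indicator:
  assumes "0 \<le> a" "a \<le> 1"
  shows "(\<integral>u. indicator {..a} u \<partial>unit_measure) = a"
    and "(\<integral>u. indicator {a<..} u \<partial>unit_measure) = 1 - a"
proof -
  have *: "(\<integral>u. indicator A u \<partial>unit_measure) = measure lborel (A \<inter> {0<..<1})"
    if "A \<in> sets borel" for A :: "real set"
    using that unfolding unit_measure_def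
    by (subst integral_restrict_space) (auto simp: Int_commute simp flip: indicator_inter_arith)
  have "{..a} \<inter> {0<..<1} = (if a = 1 then {0<..<1} else {0<..a})"
    "{a<..} \<inter> {0<..<1} = {a<..<1}"
    using assms by auto
  then show "(\<integral>u. indicator {..a} u \<partial>unit_measure) = a"
    "(\<integral>u. indicator {a<..} u \<partial>unit_measure) = 1 - a"
    using assms by (simp_all add: * del: Bochner_Integration.integral_indicator)
qed

text \<open>A null set cannot contain a left neighbourhood of a point, so left continuity upgrades
  almost everywhere equality.\<close>
lemma AE_unit_eq_imp_eq:
  fixes \<phi> \<psi> :: "real \<Rightarrow> real"
  assumes ae: "AE u in unit_measure. \<phi> u = \<psi> u"
    and "t \<in> {0<..<1}"
    and cont: "(\<phi> \<longlongrightarrow> \<phi> t) (at_left t)" "(\<psi> \<longlongrightarrow> \<psi> t) (at_left t)"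
  shows "\<phi> t = \<psi> t"
proof (rule ccontr)
  assume "\<phi> t \<noteq> \<psi> t"
  have "((\<lambda>u. \<phi> u - \<psi> u) \<longlongrightarrow> \<phi> t - \<psi> t) (at_left t)" by (intro tendsto_diff cont)
  then have "\<forall>\<^sub>F u in at_left t. \<phi> u - \<psi> u \<noteq> 0"
    by (rule tendsto_imp_eventually_ne) (use \<open>\<phi> t \<noteq> \<psi> t\<close> in auto)
  moreover have "\<forall>\<^sub>F u in at_left t. 0 < u"
    using \<open>t \<in> {0<..<1}\<close> by (auto intro: eventually_at_leftI[of 0])
  ultimately have "\<forall>\<^sub>F u in at_left t. 0 < u \<and> \<phi> u - \<psi> u \<noteq> 0" by eventually_elim auto
  then have "\<exists>b<t. \<forall>u>b. u < t \<longrightarrow> 0 < u \<and> \<phi> u - \<psi> u \<noteq> 0"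
    by (simp only: eventually_at_left_field)
  then obtain b where "b < t" and b: "\<And>u. b < u \<Longrightarrow> u < t \<Longrightarrow> 0 < u \<and> \<phi> u - \<psi> u \<noteq> 0"
    by blast
  from ae have "AE u in lborel. u \<in> {0<..<1} \<longrightarrow> \<phi> u = \<psi> u"
    unfolding unit_measure_def by (subst (asm) AE_restrict_space_iff) auto
  then have "AE u in lborel. u \<notin> {b<..<t}"
  proof eventually_elim
    case (elim u)
    then show ?case using b[of u] \<open>t \<in> {0<..<1}\<close> by auto
  qed
  then have "emeasure lborel {b<..<t} = 0"
    by (subst (asm) AE_iff_measurable[of "{b<..<t}"]) auto
  then show False using \<open>b < t\<close> by (simp add: ennreal_eq_0_iff)
qed

section \<open>Quantile functions of profiles\<close>

lemma measurable_unit [measurable (raw)]: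
  "h \<in> borel_measurable borel \<Longrightarrow> h \<in> borel_measurable unit_measure"
  by (simp add: unit_measure_def measurable_restrict_space1)

text \<open>These functions dominate the quantile functions in \<open>integrable_inv\<close>. The
  second is the reflection of the first under \<open>u \<mapsto> 1 - u\<close>.\<close>

lemma integrable_unit_powr:
  assumes "a < 1"
  shows "integrable unit_measure (\<lambda>u. u powr (- a))" "integrable unit_measure (\<lambda>u. (1 - u) powr (- a))"
proof -
  let ?f = "\<lambda>u::real. indicator {0<..<1} u * u powr (- a)"
  have "(\<lambda>u. u powr (- a)) integrable_on {0<..1::real}"
    using assms by (intro integrable_on_powr_from_0') auto
  then have "(\<lambda>u. u powr (- a)) absolutely_integrable_on {0<..1::real}"
    by (intro nonnegative_absolutely_integrable_1) auto
  then have "(\<lambda>u. u powr (- a)) absolutely_integrable_on {0<..<1::real}"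
    by (rule set_integrable_subset) auto
  then have *: "integrable lborel ?f"
    unfolding set_integrable_def by (subst (asm) integrable_completion) auto
  then show "integrable unit_measure (\<lambda>u. u powr (- a))"
    unfolding unit_measure_def by (subst integrable_restrict_space) auto
  have "integrable lborel (\<lambda>u. ?f (1 + (-1) * u))"
    by (rule lborel_integrable_real_affine[OF *]) simp
  also have "(\<lambda>u. ?f (1 + (-1) * u)) = (\<lambda>u. indicator {0<..<1} u *\<^sub>R (1 - u) powr (- a))"
    by (auto simp: indicator_def)
  finally show "integrable unit_measure (\<lambda>u. (1 - u) powr (- a))"
    unfolding unit_measure_def by (subst integrable_restrict_space) auto
qed

text \<open>With \<open>a = 1 / (1 + \<epsilon>)\<close> the tail bounds are the decay of
  \<open>profiles \<epsilon>\<close>, weakened to inequalities beyond \<open>M\<close>. Inverting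
  them bounds quantiles by powers with exponent \<open>- a\<close>, which are integrable because
  \<open>a < 1\<close>.\<close>

locale monotone_profile =
  fixes p :: "real \<Rightarrow> real" and a M :: real
  assumes mono: "mono p" and nonneg: "0 \<le> p x" and le_1: "p x \<le> 1"
    and a: "0 < a" "a < 1" and M: "1 \<le> M"
    and lower_tail: "x \<le> - M \<Longrightarrow> p x \<le> \<bar>x\<bar> powr (- inverse a)"
    and upper_tail: "M \<le> x \<Longrightarrow> 1 - p x \<le> x powr (- inverse a)"

lemma profiles_monotone_profile:
  assumes "p \<in> profiles \<epsilon>" "0 < \<epsilon>" "mono p"
  shows "\<exists>M. monotone_profile p (1 / (1 + \<epsilon>)) M"
proof -
  have "\<forall>\<^sub>F x in at_bot. \<bar>x\<bar> powr (1 + \<epsilon>) * p x < 1" "\<forall>\<^sub>F x in at_top. - 1 < x powr (1 + \<epsilon>) * (p x - 1)"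
    using assms(1) by (auto simp: profiles_def order_tendsto_iff)
  then obtain A B where A: "\<And>x. x \<le> A \<Longrightarrow> \<bar>x\<bar> powr (1 + \<epsilon>) * p x < 1"
    and B: "\<And>x. B \<le> x \<Longrightarrow> - 1 < x powr (1 + \<epsilon>) * (p x - 1)"
    unfolding eventually_at_bot_linorder eventually_at_top_linorder by blast
  define M where "M = max 1 (max (- A) B)"
  have M: "1 \<le> M" "- M \<le> A" "B \<le> M" unfolding M_def by linarith+
  have exponent: "- inverse (1 / (1 + \<epsilon>)) = - (1 + \<epsilon>)" by simp
  have "monotone_profile p (1 / (1 + \<epsilon>)) M"
  proof
    show "0 \<le> p x" "p x \<le> 1" for x using assms(1) by (auto simp: profiles_def image_subset_iff)
    show "p x \<le> \<bar>x\<bar> powr - inverse (1 / (1 + \<epsilon>))" if "x \<le> - M" for x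
    proof -
      have "0 < \<bar>x\<bar>" "\<bar>x\<bar> powr (1 + \<epsilon>) * p x < 1" using that M A[of x] by auto
      then show ?thesis unfolding exponent powr_minus_divide by (simp add: field_simps)
    qed
    show "1 - p x \<le> x powr - inverse (1 / (1 + \<epsilon>))" if "M \<le> x" for x
    proof -
      have "0 < x" "- 1 < x powr (1 + \<epsilon>) * (p x - 1)" using that M B[of x] by auto
      then show ?thesis unfolding exponent powr_minus_divide by (simp add: field_simps)
    qed
  qed (use assms M in auto)
  then show ?thesis ..
qed

context monotone_profile
begin

abbreviation X :: "real \<Rightarrow> real" where "X \<equiv> profile_inv p"

lemma measurable_p [measurable]: "p \<in> borel_measurable borel"
  using mono by (rule borel_measurable_mono)

lemma level_lower:
  assumes u: "u \<in> {0<..<1}" and "u \<le> p x"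
  shows "- (M + u powr (- a)) \<le> x"
proof (rule ccontr)
  assume "\<not> ?thesis"
  then have x: "x \<le> - M" "u powr (- a) < \<bar>x\<bar>" using M powr_ge_zero[of u "- a"] by linarith+
  have "p x \<le> \<bar>x\<bar> powr (- inverse a)" using x by (intro lower_tail)
  also have "\<dots> < (u powr (- a)) powr (- inverse a)"
    using x u a by (intro powr_less_mono2_neg) auto
  also have "\<dots> = u" using u a by (simp add: powr_powr)
  finally show False using assms by simp
qed

lemma level_upper:
  assumes u: "u \<in> {0<..<1}"
  shows "u \<le> p (M + (1 - u) powr (- a))"
proof -
  let ?x = "M + (1 - u) powr (- a)"
  have "1 - p ?x \<le> ?x powr (- inverse a)" by (rule upper_tail) simp
  also have "\<dots> \<le> ((1 - u) powr (- a)) powr (- inverse a)"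
    using M u a by (intro powr_mono2') auto
  also have "\<dots> = 1 - u" using u a by (simp add: powr_powr)
  finally show ?thesis by simp
qed

lemma level_nonempty: "u \<in> {0<..<1} \<Longrightarrow> {x. u \<le> p x} \<noteq> {}"
  using level_upper by blast

lemma level_bdd_below: "u \<in> {0<..<1} \<Longrightarrow> bdd_below {x. u \<le> p x}"
  using level_lower by (intro bdd_belowI) blast

lemma inv_le: "u \<in> {0<..<1} \<Longrightarrow> u \<le> p x \<Longrightarrow> X u \<le> x"
  unfolding profile_inv_def by (intro cInf_lower level_bdd_below) auto

text \<open>Without right continuity of \<open>p\<close>, the conditions \<open>u \<le> p x\<close>
  and \<open>X u \<le> x\<close> may disagree at \<open>x = X u\<close>; hence the strict inequality
  in this converse of \<open>inv_le\<close>.\<close>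

lemma inv_less: "u \<in> {0<..<1} \<Longrightarrow> X u < x \<Longrightarrow> u \<le> p x"
  using cInf_lessD[OF level_nonempty, of u x] monoD[OF mono] unfolding profile_inv_def
  by (metis less_imp_le mem_Collect_eq order_trans)

lemma inv_mono_on: "mono_on {0<..<1} X"
  unfolding profile_inv_def
  by (intro mono_onI cInf_superset_mono level_nonempty level_bdd_below) auto

lemma measurable_inv [measurable]: "X \<in> borel_measurable unit_measure"
  using borel_measurable_mono_on_fnc[OF inv_mono_on] by (simp cong: measurable_cong_sets add: sets_unit_measure)

text \<open>For \<open>c < X t\<close> the profile at \<open>c\<close> is strictly below
  \<open>t\<close>, so positive levels between \<open>p c\<close> and \<open>t\<close> already have
  quantile at least \<open>c\<close>. This feeds \<open>AE_unit_eq_imp_eq\<close>.\<close>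

lemma inv_left_cont:
  assumes t: "t \<in> {0<..<1}"
  shows "(X \<longlongrightarrow> X t) (at_left t)"
proof (rule order_tendstoI)
  fix b assume "b < X t"
  then obtain c where c: "b < c" "c < X t" using dense by blast
  then have "p c < t" using inv_le[OF t, of c] by linarith
  have "\<forall>\<^sub>F u in at_left t. max 0 (p c) < u \<and> u < t"
    using t \<open>p c < t\<close> by (intro eventually_at_leftI[of "max 0 (p c)"]) auto
  then show "\<forall>\<^sub>F u in at_left t. b < X u"
  proof eventually_elim
    case (elim u)
    then have "u \<in> {0<..<1}" "\<not> u \<le> p c" using t by auto
    then have "c \<le> X u" using inv_less[of u c] by linarith
    then show ?case using c by simp
  qed
next
  fix b assume "X t < b"
  have "\<forall>\<^sub>F u in at_left t. 0 < u \<and> u < t"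
    using t by (intro eventually_at_leftI[of 0]) auto
  then show "\<forall>\<^sub>F u in at_left t. X u < b"
  proof eventually_elim
    case (elim u)
    then have "X u \<le> X t" using t by (intro mono_onD[OF inv_mono_on]) auto
    then show ?case using \<open>X t < b\<close> by simp
  qed
qed

lemma inv_bound:
  assumes u: "u \<in> {0<..<1}"
  shows "\<bar>X u\<bar> \<le> M + (u powr (- a) + (1 - u) powr (- a))"
proof -
  have "X u \<le> M + (1 - u) powr (- a)" using u by (intro inv_le level_upper)
  moreover have "- (M + u powr (- a)) \<le> X u"
    unfolding profile_inv_def by (intro cInf_greatest level_nonempty u) (use level_lower[OF u] in auto)
  ultimately show ?thesis
    using M powr_ge_zero[of u "- a"] powr_ge_zero[of "1 - u" "- a"] by linarith
qed

text \<open>A finite first moment of the profile, which makes the test function in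
  \<open>overlap_eq\<close> integrable.\<close>

lemma integrable_inv: "integrable unit_measure X"
proof (rule Bochner_Integration.integrable_bound)
  show "integrable unit_measure (\<lambda>u. M + (u powr (- a) + (1 - u) powr (- a)))"
    using a by (intro Bochner_Integration.integrable_add integrable_unit_powr unit.integrable_const)
  show "AE u in unit_measure. norm (X u) \<le> norm (M + (u powr (- a) + (1 - u) powr (- a)))"
    by (intro AE_I2) (use inv_bound in force)
qed simp

text \<open>Layer cake: \<open>p y\<close> is the measure of the levels \<open>u \<le> p y\<close>.
  After Fubini the integral over \<open>y\<close> runs over a half-line starting at
  \<open>X u\<close>.\<close>

lemma conv_eq:
  assumes w: "window w"
  shows "conv p w x = (\<integral>u. cumulative w (x - X u) \<partial>unit_measure)"
proof -
  have w_int: "integrable lborel w" and w_nonneg: "0 \<le> w y" for y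
    using w by (auto simp: window_def)
  then have [measurable]: "w \<in> borel_measurable borel" by auto
  have w_int': "integrable lborel (\<lambda>y. w (x - y))"
    using lborel_integrable_real_affine[OF w_int, of "-1" x] by simp
  have inner: "(\<integral>u. indicator {..p y} u * w (x - y) \<partial>unit_measure) = p y * w (x - y)" for y
    using integral_unit_indicator(1)[OF nonneg[of y] le_1[of y]] by simp
  have norm: "norm (indicator {..p y} u * w (x - y)) = indicator {..p y} u * w (x - y)" for y u
    using w_nonneg by (simp add: indicator_def)
  have int: "integrable (lborel \<Otimes>\<^sub>M unit_measure) (\<lambda>(y, u). indicator {..p y} u * w (x - y))"
  proof (rule lborel_unit.Fubini_integrable)
    show "(\<lambda>(y, u). indicator {..p y} u * w (x - y)) \<in> borel_measurable (lborel \<Otimes>\<^sub>M unit_measure)"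
    proof -
      have [measurable]: "snd \<in> borel_measurable (lborel \<Otimes>\<^sub>M unit_measure)"
        by (rule measurable_compose[OF measurable_snd measurable_unit, of "\<lambda>u. u", simplified])
      have [measurable]: "(\<lambda>z. w (x - fst z)) \<in> borel_measurable (lborel \<Otimes>\<^sub>M unit_measure)"
        by (rule measurable_compose[OF measurable_fst]) simp
      have "(\<lambda>(y, u). indicator {..p y} u * w (x - y))
          = (\<lambda>z. if snd z \<le> p (fst z) then w (x - fst z) else 0)"
        by (auto simp: indicator_def)
      then show ?thesis by simp
    qed
    have "integrable lborel (\<lambda>y. p y * w (x - y))"
      by (rule Bochner_Integration.integrable_bound[OF w_int'])
        (use nonneg le_1 w_nonneg in \<open>auto intro!: mult_left_le_one_le\<close>)
    then show "integrable lborel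
        (\<lambda>y. \<integral>u. norm (case (y, u) of (y, u) \<Rightarrow> indicator {..p y} u * w (x - y)) \<partial>unit_measure)"
      by (simp only: prod.case norm inner)
    show "AE y in lborel. integrable unit_measure (\<lambda>u. case (y, u) of (y, u) \<Rightarrow> indicator {..p y} u * w (x - y))"
    proof (rule AE_I2)
      fix y
      show "integrable unit_measure (\<lambda>u. case (y, u) of (y, u) \<Rightarrow> indicator {..p y} u * w (x - y))"
        unfolding prod.case
        by (rule unit.integrable_const_bound[where B = "w (x - y)"])
          (auto simp: indicator_def w_nonneg)
    qed
  qed
  have "conv p w x = (LBINT y. \<integral>u. indicator {..p y} u * w (x - y) \<partial>unit_measure)"
    unfolding inner conv_def ..
  also have "\<dots> = (\<integral>u. (LBINT y. indicator {..p y} u * w (x - y)) \<partial>unit_measure)"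
    using lborel_unit.Fubini_integral[OF int] by simp
  also have "\<dots> = (\<integral>u. cumulative w (x - X u) \<partial>unit_measure)"
  proof (rule Bochner_Integration.integral_cong[OF refl])
    fix u assume "u \<in> space unit_measure"
    then have u: "u \<in> {0<..<1}" by simp
    have [measurable]: "(\<lambda>y. w (x - y)) \<in> borel_measurable lborel" using w_int' by auto
    have "(\<lambda>y. indicator {..p y} u) = (\<lambda>y. if u \<le> p y then 1 else (0::real))"
      by (auto simp: indicator_def)
    then have [measurable]: "(\<lambda>y. indicator {..p y} u :: real) \<in> borel_measurable lborel" by simp
    have "(LBINT y. indicator {..p y} u * w (x - y)) = (LBINT y. indicator {X u..} y * w (x - y))"
    proof (rule integral_cong_AE)
      \<comment> \<open>The end point \<open>X u\<close> may or may not belong to the superlevel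
        set.\<close>
      have "AE y in lborel. y \<noteq> X u" by (rule AE_lborel_singleton)
      then show "AE y in lborel. indicator {..p y} u * w (x - y) = indicator {X u..} y * w (x - y)"
      proof eventually_elim
        case (elim y)
        then show ?case using inv_le[OF u, of y] inv_less[OF u, of y] by (auto simp: indicator_def)
      qed
    qed simp_all
    then show "(LBINT y. indicator {..p y} u * w (x - y)) = cumulative w (x - X u)"
      by (simp add: window_tail_integral[OF w])
  qed
  finally show ?thesis .
qed

end

lemma measure_unit [simp]: "measure unit_measure {0<..<1} = 1"
  using prob_emeasure_unit by (simp add: measure_def)

lemma integral_unit_const: "(\<integral>u. (c::real) \<partial>unit_measure) = c"
  by simp

context monotone_profile
begin

lemma integrable_cumulative:
  assumes w: "window w"
  shows "integrable unit_measure (\<lambda>u. cumulative w (x - X u))"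
proof (rule unit.integrable_const_bound[where B = 1])
  note [measurable] = measurable_cumulative[OF w]
  show "(\<lambda>u. cumulative w (x - X u)) \<in> borel_measurable unit_measure" by measurable
qed (use cumulative_nonneg[OF w] cumulative_le_1[OF w] in auto)

lemma conv_nonneg: "window w \<Longrightarrow> 0 \<le> conv p w x"
  by (auto simp: conv_eq cumulative_nonneg intro: Bochner_Integration.integral_nonneg)

lemma conv_le_1: "window w \<Longrightarrow> conv p w x \<le> 1"
  using integral_mono[OF integrable_cumulative unit.integrable_const, of w x 1]
  by (simp only: conv_eq cumulative_le_1 integral_unit_const)

lemma isCont_conv:
  assumes w: "window w"
  shows "isCont (conv p w) x"
proof -
  obtain B where B: "B-lipschitz_on UNIV (cumulative w)" using lipschitz_cumulative[OF w] by blast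
  have "B-lipschitz_on UNIV (conv p w)"
  proof (rule lipschitz_onI)
    fix x y
    have "dist (conv p w x) (conv p w y)
        = norm (\<integral>u. cumulative w (x - X u) - cumulative w (y - X u) \<partial>unit_measure)"
      by (simp add: dist_norm conv_eq[OF w] integrable_cumulative[OF w])
    also have "\<dots> \<le> (\<integral>u. norm (cumulative w (x - X u) - cumulative w (y - X u)) \<partial>unit_measure)"
      by (rule integral_norm_bound)
    also have "\<dots> \<le> (\<integral>u. B * dist x y \<partial>unit_measure)"
    proof (rule integral_mono)
      show "norm (cumulative w (x - X u) - cumulative w (y - X u)) \<le> B * dist x y" for u
        using lipschitz_onD[OF B, of "x - X u" "y - X u"] by (simp add: dist_norm)
    qed (simp_all add: integrable_cumulative[OF w])
    also have "\<dots> = B * dist x y" by (rule integral_unit_const)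
    finally show "dist (conv p w x) (conv p w y) \<le> B * dist x y" .
  qed (rule lipschitz_on_nonneg[OF B])
  then show ?thesis
    using lipschitz_on_continuous_on continuous_on_eq_continuous_at open_UNIV by blast
qed

text \<open>\<open>X v\<close> is where \<open>p\<close> crosses \<open>v\<close>: left of it
  \<open>h (F x) < v\<close>, right of it \<open>v \<le> h (F x)\<close>. Continuity of
  \<open>F\<close> squeezes \<open>F (X v)\<close> to the left continuous inverse of
  \<open>h\<close> at \<open>v\<close>, which does not depend on \<open>p\<close>; this makes two
  fixed points comparable.\<close>

lemma level_eq:
  assumes h: "update_fun h" and F: "\<And>x. isCont F x" "\<And>x. F x \<in> {0..1}" and p: "\<And>x. p x = h (F x)"
    and v: "v \<in> {0<..<1}"
  shows "F (X v) = Sup {s \<in> {0..1}. h s < v}"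
proof (rule antisym)
  have bdd: "bdd_above {s \<in> {0..1}. h s < v}" by (rule bdd_aboveI[of _ 1]) auto
  show "F (X v) \<le> Sup {s \<in> {0..1}. h s < v}"
  proof (rule tendsto_upperbound)
    show "(F \<longlongrightarrow> F (X v)) (at_left (X v))"
      using F(1) by (simp add: isCont_def filterlim_at_split)
    have "F x \<le> Sup {s \<in> {0..1}. h s < v}" if "x < X v" for x
      using inv_le[OF v, of x] that F(2)[of x] p[of x] by (intro cSup_upper bdd) force
    then show "\<forall>\<^sub>F x in at_left (X v). F x \<le> Sup {s \<in> {0..1}. h s < v}"
      by (simp add: eventually_at_filter)
  qed simp
  show "Sup {s \<in> {0..1}. h s < v} \<le> F (X v)"
  proof (rule cSup_least)
    show "{s \<in> {0..1}. h s < v} \<noteq> {}" using h v by (auto simp: update_fun_def intro!: exI[of _ 0])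
    fix s assume s: "s \<in> {s \<in> {0..1}. h s < v}"
    show "s \<le> F (X v)"
    proof (rule tendsto_lowerbound)
      show "(F \<longlongrightarrow> F (X v)) (at_right (X v))"
        using F(1) by (simp add: isCont_def filterlim_at_split)
      have "s \<le> F x" if "X v < x" for x
      proof (rule ccontr)
        assume "\<not> s \<le> F x"
        then have "h (F x) \<le> h s"
          using h s F(2)[of x] by (auto simp: update_fun_def intro: mono_onD)
        then show False using inv_less[OF v that] p[of x] s by auto
      qed
      then show "\<forall>\<^sub>F x in at_right (X v). s \<le> F x" by (simp add: eventually_at_filter)
    qed simp
  qed
qed

end

section \<open>Generalized inverses of update functions\<close>

lemma update_inv_mono_on:
  assumes h: "update_fun h"
  shows "mono_on {0..} (update_inv h)"
  unfolding update_inv_def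
proof (intro mono_onI cSup_subset_mono)
  fix r :: real assume "r \<in> {0..}"
  then show "{v \<in> {0..1}. h v \<le> r} \<noteq> {}"
    using h by (auto simp: update_fun_def intro!: exI[of _ 0])
  show "bdd_above {v \<in> {0..1}. h v \<le> s}" for s by (rule bdd_aboveI[of _ 1]) auto
qed auto

lemma update_inv_bounds:
  assumes h: "update_fun h" and "0 \<le> u"
  shows "0 \<le> update_inv h u" "update_inv h u \<le> 1"
proof -
  have bdd: "bdd_above {v \<in> {0..1}. h v \<le> u}" by (rule bdd_aboveI[of _ 1]) auto
  have 0: "0 \<in> {v \<in> {0..1}. h v \<le> u}" using assms by (simp add: update_fun_def)
  show "0 \<le> update_inv h u" unfolding update_inv_def by (rule cSup_upper[OF 0 bdd])
  show "update_inv h u \<le> 1" unfolding update_inv_def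
  proof (rule cSup_least)
    show "{v \<in> {0..1}. h v \<le> u} \<noteq> {}" using 0 by blast
  qed auto
qed

text \<open>\<open>update_inv h\<close> and the left continuous inverse differ only at the jumps of the former.\<close>
lemma AE_update_inv_le:
  assumes h: "update_fun h"
  shows "AE v in unit_measure. update_inv h v \<le> Sup {s \<in> {0..1}. h s < v}"
proof -
  let ?D = "{v \<in> {0<..<1}. \<not> isCont (update_inv h) v}"
  have "mono_on {0<..<1} (update_inv h)"
    using update_inv_mono_on[OF h] by (rule mono_on_subset) auto
  then have "countable ?D" by (intro mono_on_ctble_discont_open) auto
  then have "AE v in lborel. v \<notin> ?D" by (intro AE_not_in countable_imp_null_set_lborel)
  then have "AE v in lborel. v \<in> {0<..<1} \<longrightarrow> update_inv h v \<le> Sup {s \<in> {0..1}. h s < v}"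
  proof (eventually_elim, intro impI)
    fix v assume "v \<notin> ?D" and v: "v \<in> {0<..<1::real}"
    then have cont: "isCont (update_inv h) v" by blast
    \<comment> \<open>At a continuity point the value is the limit from the left, and for
      \<open>t < v\<close> the condition \<open>h s \<le> t\<close> implies
      \<open>h s < v\<close>.\<close>
    show "update_inv h v \<le> Sup {s \<in> {0..1}. h s < v}"
    proof (rule tendsto_upperbound)
      show "(update_inv h \<longlongrightarrow> update_inv h v) (at_left v)"
        using cont by (simp add: isCont_def filterlim_at_split)
      have "\<forall>\<^sub>F t in at_left v. 0 < t \<and> t < v" using v by (intro eventually_at_leftI[of 0]) auto
      then show "\<forall>\<^sub>F t in at_left v. update_inv h t \<le> Sup {s \<in> {0..1}. h s < v}"
      proof eventually_elim
        case (elim t)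
        have "bdd_above {s \<in> {0..1}. h s < v}" by (rule bdd_aboveI[of _ 1]) auto
        then show ?case unfolding update_inv_def
          using elim h by (intro cSup_subset_mono) (auto simp: update_fun_def intro!: exI[of _ 0])
      qed
    qed simp
  qed
  then show ?thesis unfolding unit_measure_def by (subst AE_restrict_space_iff) auto
qed

section \<open>A single fixed point\<close>

lemma integrable_unit_pair_bounded:
  assumes "\<phi> \<in> borel_measurable (unit_measure \<Otimes>\<^sub>M unit_measure)" "\<And>z. \<bar>\<phi> z\<bar> \<le> (1::real)"
  shows "integrable (unit_measure \<Otimes>\<^sub>M unit_measure) \<phi>"
proof -
  interpret P: finite_measure "unit_measure \<Otimes>\<^sub>M unit_measure"
    by (intro finite_measure_pair_measure) unfold_locales
  show ?thesis using assms by (intro P.integrable_const_bound[where B = 1]) auto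
qed

lemma measurable_unit_fst_snd [measurable]:
  "fst \<in> borel_measurable (unit_measure \<Otimes>\<^sub>M unit_measure)"
  "snd \<in> borel_measurable (unit_measure \<Otimes>\<^sub>M unit_measure)"
  using measurable_compose[OF measurable_fst measurable_unit, of "\<lambda>u. u"]
    measurable_compose[OF measurable_snd measurable_unit, of "\<lambda>u. u"] by simp_all

locale transition_wave =
  f: monotone_profile f a M + g: monotone_profile g b N
  for f g :: "real \<Rightarrow> real" and a b M N :: real +
  fixes w hf hg :: "real \<Rightarrow> real"
  assumes w: "window w" and hf: "update_fun hf" and hg: "update_fun hg"
    and fixed: "fixed_point hf hg w f g"
begin

text \<open>Interaction of level \<open>u\<close> of \<open>f\<close> with level \<open>v\<close> of
  \<open>g\<close>; the two levels count as interacting when the value is strictly between 0 and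
  1.\<close>

abbreviation overlap :: "real \<Rightarrow> real \<Rightarrow> real" where
  "overlap u v \<equiv> cumulative w (g.X v - f.X u)"

lemma measurable_overlap [measurable]:
  "(\<lambda>z. overlap (fst z) (snd z)) \<in> borel_measurable (unit_measure \<Otimes>\<^sub>M unit_measure)"
proof -
  note [measurable] = measurable_cumulative[OF w]
  show ?thesis by measurable
qed

lemma integrable_overlap_fst: "integrable unit_measure (\<lambda>u. overlap u v)"
  by (rule f.integrable_cumulative[OF w])

text \<open>Evenness exchanges the roles of \<open>f\<close> and \<open>g\<close>, so that integrals
  over \<open>v\<close> become convolutions of \<open>g\<close>.\<close>

lemma overlap_flip: "overlap u v = 1 - cumulative w (f.X u - g.X v)"
  using cumulative_minus[OF w, of "f.X u - g.X v"] by simp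

lemma integrable_overlap_snd: "integrable unit_measure (\<lambda>v. overlap u v)"
  unfolding overlap_flip using g.integrable_cumulative[OF w] by simp

text \<open>\<open>conv_eq\<close> identifies the left side with \<open>conv f w\<close> at
  \<open>g.X v\<close>, and \<open>level_eq\<close> evaluates this from \<open>hg\<close> and
  \<open>v\<close> alone.\<close>

lemma integral_overlap_fst:
  assumes "v \<in> {0<..<1}"
  shows "(\<integral>u. overlap u v \<partial>unit_measure) = Sup {s \<in> {0..1}. hg s < v}"
  using g.level_eq[OF hg f.isCont_conv[OF w] _ _ assms] fixed f.conv_nonneg[OF w] f.conv_le_1[OF w]
  by (simp add: f.conv_eq[OF w] fixed_point_def)

lemma conv_at_f_level:
  assumes "u \<in> {0<..<1}"
  shows "conv g w (f.X u) = Sup {s \<in> {0..1}. hf s < u}"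
  using f.level_eq[OF hf g.isCont_conv[OF w] _ _ assms] fixed g.conv_nonneg[OF w] g.conv_le_1[OF w]
  by (simp add: fixed_point_def)

lemma integral_overlap_snd: "(\<integral>v. overlap u v \<partial>unit_measure) = 1 - conv g w (f.X u)"
  unfolding overlap_flip using g.integrable_cumulative[OF w]
  by (simp add: g.conv_eq[OF w] integral_unit_const)

lemma overlap_mono_snd:
  "v \<in> {0<..<1} \<Longrightarrow> v' \<in> {0<..<1} \<Longrightarrow> v \<le> v' \<Longrightarrow> overlap u v \<le> overlap u v'"
  using mono_onD[OF g.inv_mono_on, of v v'] by (intro cumulative_mono[OF w]) auto

lemma overlap_left_cont:
  assumes "t \<in> {0<..<1}"
  shows "((\<lambda>v. overlap u v) \<longlongrightarrow> overlap u t) (at_left t)" "((\<lambda>u. overlap u v) \<longlongrightarrow> overlap t v) (at_left t)"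
  by (intro isCont_tendsto_compose[OF isCont_cumulative[OF w]] tendsto_intros
      f.inv_left_cont g.inv_left_cont assms)+

lemma integrable_updates:
  "integrable unit_measure (\<lambda>v. indicator {..t} v * update_inv hg v)"
  "integrable unit_measure (\<lambda>v. indicator {..t} v * hf v)"
proof -
  have meas: "h \<in> borel_measurable unit_measure" if "mono_on {0<..<1} h" for h :: "real \<Rightarrow> real"
    using borel_measurable_mono_on_fnc[OF that]
    by (simp cong: measurable_cong_sets add: sets_unit_measure)
  have [measurable]: "update_inv hg \<in> borel_measurable unit_measure"
    by (rule meas, rule mono_on_subset[OF update_inv_mono_on[OF hg]]) auto
  have [measurable]: "hf \<in> borel_measurable unit_measure"
    by (rule meas, rule mono_on_subset[of "{0..1}"]) (use hf in \<open>auto simp: update_fun_def\<close>)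
  have "\<bar>hf v\<bar> \<le> 1" if "v \<in> {0<..<1}" for v
    using hf that by (auto simp: update_fun_def Pi_iff abs_le_iff intro: order_trans[of _ 0])
  moreover have "\<bar>update_inv hg v\<bar> \<le> 1" if "v \<in> {0<..<1}" for v
    using update_inv_bounds[OF hg, of v] that by auto
  ultimately show "integrable unit_measure (\<lambda>v. indicator {..t} v * update_inv hg v)"
    "integrable unit_measure (\<lambda>v. indicator {..t} v * hf v)"
    by (intro unit.integrable_const_bound[where B = 1] AE_I2; simp add: indicator_def)+
qed

lemma gap_unit:
  assumes "t \<in> {0<..<1}"
  shows "gap hf hg t = (\<integral>v. indicator {..t} v * update_inv hg v \<partial>unit_measure)
    - (\<integral>v. indicator {..t} v * hf v \<partial>unit_measure)"
proof -
  \<comment> \<open>The integrands differ only at 0, which lies in \<open>{0..t}\<close> but not in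
    the open unit interval.\<close>
  have "gap hf hg t = (LBINT v. indicator {0<..<1} v *\<^sub>R
      (indicator {..t} v * update_inv hg v - indicator {..t} v * hf v))"
    unfolding gap_def set_lebesgue_integral_def
    by (rule integral_discrete_difference[of "{0}"]) (use assms in \<open>auto simp: indicator_def\<close>)
  also have "\<dots> = (\<integral>v. indicator {..t} v * update_inv hg v - indicator {..t} v * hf v \<partial>unit_measure)"
    unfolding unit_measure_def by (subst integral_restrict_space) auto
  also have "\<dots> = (\<integral>v. indicator {..t} v * update_inv hg v \<partial>unit_measure)
    - (\<integral>v. indicator {..t} v * hf v \<partial>unit_measure)"
    by (intro Bochner_Integration.integral_diff integrable_updates)
  finally show ?thesis .
qed

text \<open>If no level \<open>v > t\<close> of \<open>g\<close> interacts with the levels \<open>u\<close> of \<open>f\<close> that are reached from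
  below \<open>t\<close>, then the wave restricted to these levels is a wave of its own, and Young's inequality
  for \<open>hf\<close> bounds the gap at \<open>t\<close>.\<close>
lemma gap_nonpos:
  assumes t: "t \<in> {0<..<1}"
    and sep: "\<And>u v. u \<in> {0<..<1} \<Longrightarrow> v \<in> {t<..<1} \<Longrightarrow> 0 < overlap u t \<Longrightarrow> overlap u v = 1"
  shows "gap hf hg t \<le> 0"
proof -
  \<comment> \<open>\<open>?\<phi>\<close> is the overlap of the separated wave: levels
    \<open>v \<le> t\<close> and the levels \<open>u\<close> reached from \<open>t\<close>. For the
    same levels \<open>?\<psi>\<close> indicates the region above the graph of
    \<open>u \<mapsto> conv g w (f.X u)\<close>; its area lies between the integrals of
    \<open>update_inv hg\<close> and \<open>hf\<close>.\<close>
  let ?\<phi> = "\<lambda>u v. if 0 < overlap u t \<and> v \<le> t then overlap u v else 0"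
  let ?\<psi> = "\<lambda>u v. if 0 < overlap u t \<and> v \<le> t \<and> conv g w (f.X u) < v then 1 else 0 :: real"
  have [measurable]: "conv g w \<in> borel_measurable borel"
    using g.isCont_conv[OF w]
    by (intro borel_measurable_continuous_onI continuous_at_imp_continuous_on) auto
  note [measurable] = measurable_cumulative[OF w]
  have abs_\<phi>: "\<bar>?\<phi> u v\<bar> \<le> 1" for u v
    using cumulative_nonneg[OF w, of "g.X v - f.X u"] cumulative_le_1[OF w, of "g.X v - f.X u"] by simp
  have int_\<phi>: "integrable (unit_measure \<Otimes>\<^sub>M unit_measure) (\<lambda>(u, v). ?\<phi> u v)"
    unfolding case_prod_beta'
  proof (rule integrable_unit_pair_bounded)
    show "(\<lambda>z. ?\<phi> (fst z) (snd z)) \<in> borel_measurable (unit_measure \<Otimes>\<^sub>M unit_measure)"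
      by measurable
  qed (rule abs_\<phi>)
  have int_\<psi>: "integrable (unit_measure \<Otimes>\<^sub>M unit_measure) (\<lambda>(u, v). ?\<psi> u v)"
    unfolding case_prod_beta'
  proof (rule integrable_unit_pair_bounded)
    show "(\<lambda>z. ?\<psi> (fst z) (snd z)) \<in> borel_measurable (unit_measure \<Otimes>\<^sub>M unit_measure)"
      by measurable
  qed simp
  have bounded: "integrable unit_measure k" if "k \<in> borel_measurable unit_measure" "\<And>v. \<bar>k v\<bar> \<le> 1"
    for k :: "real \<Rightarrow> real"
    using that by (intro unit.integrable_const_bound[where B = 1]) auto
  have bounded_\<psi>1: "integrable unit_measure (\<lambda>u. ?\<psi> u v)" for v
  proof (rule bounded)
    show "(\<lambda>u. ?\<psi> u v) \<in> borel_measurable unit_measure" by measurable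
  qed simp
  have bounded_\<psi>2: "integrable unit_measure (\<lambda>v. ?\<psi> u v)" for u
  proof (rule bounded)
    show "(\<lambda>v. ?\<psi> u v) \<in> borel_measurable unit_measure" by measurable
  qed simp
  note bounded_\<psi> = bounded_\<psi>1 bounded_\<psi>2
  have "(\<integral>v. indicator {..t} v * update_inv hg v \<partial>unit_measure) \<le> (\<integral>v. \<integral>u. ?\<phi> u v \<partial>unit_measure \<partial>unit_measure)"
  proof (rule integral_mono_AE[OF integrable_updates(1)])
    show "integrable unit_measure (\<lambda>v. \<integral>u. ?\<phi> u v \<partial>unit_measure)"
      by (rule unit_pair.integrable_snd[OF int_\<phi>])
    have "AE v in unit_measure. v \<in> {0<..<1}" by (intro AE_I2) simp
    with AE_update_inv_le[OF hg]
    show "AE v in unit_measure. indicator {..t} v * update_inv hg v \<le> (\<integral>u. ?\<phi> u v \<partial>unit_measure)"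
    proof eventually_elim
      case (elim v)
      \<comment> \<open>Levels of \<open>f\<close> not reached from \<open>t\<close> have zero
        overlap with all \<open>v \<le> t\<close>, so dropping them loses nothing.\<close>
      have "overlap u v = 0" if "\<not> 0 < overlap u t" "v \<le> t" for u
        using overlap_mono_snd[OF elim(2) t that(2), of u] that(1) cumulative_nonneg[OF w, of "g.X v - f.X u"]
        by linarith
      then have "?\<phi> u v = indicator {..t} v * overlap u v" for u by (auto simp: indicator_def)
      then show ?case using elim(1) integral_overlap_fst[OF elim(2)] by (auto simp: indicator_def)
    qed
  qed
  also have "\<dots> = (\<integral>u. \<integral>v. ?\<phi> u v \<partial>unit_measure \<partial>unit_measure)"
    by (rule unit_pair.Fubini_integral[OF int_\<phi>])
  also have "\<dots> \<le> (\<integral>u. \<integral>v. ?\<psi> u v \<partial>unit_measure \<partial>unit_measure)"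
  proof (rule integral_mono)
    show "integrable unit_measure (\<lambda>u. \<integral>v. ?\<phi> u v \<partial>unit_measure)"
      "integrable unit_measure (\<lambda>u. \<integral>v. ?\<psi> u v \<partial>unit_measure)"
      using unit_pair.integrable_fst[OF int_\<phi>] unit_pair.integrable_fst[OF int_\<psi>] by simp_all
    fix u assume "u \<in> space unit_measure"
    then have u: "u \<in> {0<..<1}" by simp
    show "(\<integral>v. ?\<phi> u v \<partial>unit_measure) \<le> (\<integral>v. ?\<psi> u v \<partial>unit_measure)"
    proof (cases "0 < overlap u t")
      case True
      let ?G = "conv g w (f.X u)"
      \<comment> \<open>By \<open>sep\<close> the overlap is 1 above \<open>t\<close>, so cutting
        off \<open>v > t\<close> subtracts exactly the length \<open>1 - t\<close>.\<close>
      have "(\<integral>v. ?\<phi> u v \<partial>unit_measure) = (\<integral>v. overlap u v - indicator {t<..} v \<partial>unit_measure)"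
        using sep[OF u _ True] True
        by (intro Bochner_Integration.integral_cong) (auto simp: indicator_def not_le)
      also have "\<dots> = (\<integral>v. overlap u v \<partial>unit_measure) - (\<integral>v. indicator {t<..} v \<partial>unit_measure)"
        by (intro Bochner_Integration.integral_diff integrable_overlap_snd bounded) auto
      also have "\<dots> = t - ?G"
        using t by (subst integral_unit_indicator) (auto simp: integral_overlap_snd)
      also have "\<dots> = (\<integral>v. indicator {..t} v \<partial>unit_measure) - (\<integral>v. indicator {..?G} v \<partial>unit_measure)"
        using t g.conv_nonneg[OF w] g.conv_le_1[OF w] by (subst (1 2) integral_unit_indicator) auto
      also have "\<dots> = (\<integral>v. indicator {..t} v - indicator {..?G} v \<partial>unit_measure)"
        by (intro Bochner_Integration.integral_diff[symmetric] bounded) auto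
      \<comment> \<open>The difference of indicators is 1 only for \<open>?G < v \<le> t\<close> and
        at most 0 elsewhere, so the bound also holds when \<open>t < ?G\<close>.\<close>
      also have "\<dots> \<le> (\<integral>v. ?\<psi> u v \<partial>unit_measure)"
        by (intro integral_mono bounded_\<psi> Bochner_Integration.integrable_diff bounded)
          (use True in \<open>auto simp: indicator_def\<close>)
      finally show ?thesis .
    qed simp
  qed
  also have "\<dots> = (\<integral>v. \<integral>u. ?\<psi> u v \<partial>unit_measure \<partial>unit_measure)"
    by (rule unit_pair.Fubini_integral[OF int_\<psi>, symmetric])
  also have "\<dots> \<le> (\<integral>v. indicator {..t} v * hf v \<partial>unit_measure)"
  proof (rule integral_mono[OF _ integrable_updates(2)])
    show "integrable unit_measure (\<lambda>v. \<integral>u. ?\<psi> u v \<partial>unit_measure)"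
      by (rule unit_pair.integrable_snd[OF int_\<psi>])
    fix v assume "v \<in> space unit_measure"
    then have v: "v \<in> {0<..<1}" by simp
    then have hfv: "0 \<le> hf v" "hf v \<le> 1" using hf by (auto simp: update_fun_def Pi_iff)
    \<comment> \<open>The core of Young's inequality: \<open>hf v < u\<close> puts \<open>v\<close>
      into the set whose supremum is \<open>conv g w (f.X u)\<close>.\<close>
    have "u \<le> hf v" if u: "u \<in> {0<..<1}" and "conv g w (f.X u) < v" for u
    proof (rule ccontr)
      assume "\<not> u \<le> hf v"
      then have "v \<le> Sup {s \<in> {0..1}. hf s < u}"
        using v by (intro cSup_upper bdd_aboveI[of _ 1]) auto
      then show False using that conv_at_f_level[OF u] by simp
    qed
    then have "(\<integral>u. ?\<psi> u v \<partial>unit_measure) \<le> (\<integral>u. indicator {..t} v * indicator {..hf v} u \<partial>unit_measure)"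
      by (intro integral_mono bounded_\<psi> bounded) (auto simp: indicator_def)
    also have "\<dots> = indicator {..t} v * hf v"
      using integral_unit_indicator(1)[OF hfv] by simp
    finally show "(\<integral>u. ?\<psi> u v \<partial>unit_measure) \<le> indicator {..t} v * hf v" .
  qed
  finally show ?thesis unfolding gap_unit[OF t] by simp
qed

end

section \<open>Comparing two fixed points\<close>

text \<open>Quantiles fix a profile only up to its values at jumps, which a convolution does not
  see. Pointwise equality is recovered from the fixed point equations in
  \<open>translates\<close>.\<close>

lemma conv_shift:
  fixes c :: real
  assumes p: "monotone_profile p a M" and q: "monotone_profile q b N" and w: "window w"
    and eq: "\<And>u. u \<in> {0<..<1} \<Longrightarrow> profile_inv q u = profile_inv p u + c"
  shows "conv q w x = conv p w (x - c)"
proof -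
  interpret p: monotone_profile p a M by fact
  interpret q: monotone_profile q b N by fact
  show ?thesis unfolding p.conv_eq[OF w] q.conv_eq[OF w]
  proof (rule Bochner_Integration.integral_cong)
    fix u assume "u \<in> space unit_measure"
    then have "profile_inv q u = profile_inv p u + c" by (intro eq) simp
    then have "x - profile_inv q u = x - c - profile_inv p u" by simp
    then show "cumulative w (x - profile_inv q u) = cumulative w (x - c - profile_inv p u)"
      by (rule arg_cong)
  qed simp
qed

lemma conv_translate: "conv (\<lambda>y. p (y - c)) w x = conv p w (x - c)"
proof -
  have "conv p w (x - c) = (LBINT y. p (- c + 1 * y) * w (x - c - (- c + 1 * y)))"
    unfolding conv_def by (subst lborel_integral_real_affine[of 1 _ "- c"]) simp_all
  then show ?thesis by (simp add: conv_def)
qed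

locale two_waves =
  zero: transition_wave f0 g0 a0 b0 M0 N0 w hf hg + one: transition_wave f1 g1 a1 b1 M1 N1 w hf hg
  for f0 g0 f1 g1 and a0 b0 M0 N0 a1 b1 M1 N1 :: real and w hf hg
begin

abbreviation X0 :: "real \<Rightarrow> real" where "X0 \<equiv> profile_inv f0"
abbreviation Y0 :: "real \<Rightarrow> real" where "Y0 \<equiv> profile_inv g0"
abbreviation X1 :: "real \<Rightarrow> real" where "X1 \<equiv> profile_inv f1"
abbreviation Y1 :: "real \<Rightarrow> real" where "Y1 \<equiv> profile_inv g1"

text \<open>Both marginals of the difference \<open>K\<close> of the two overlaps vanish, so \<open>K\<close> is orthogonal to the
  difference of the arguments of \<open>cumulative w\<close>; by monotonicity their product has a sign.\<close>
lemma overlap_eq: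
  assumes u: "u \<in> {0<..<1}" and v: "v \<in> {0<..<1}"
  shows "one.overlap u v = zero.overlap u v"
proof -
  note w = zero.w
  define K where "K u v = one.overlap u v - zero.overlap u v" for u v
  define dX where "dX u = X1 u - X0 u" for u
  define dY where "dY v = Y1 v - Y0 v" for v
  have [measurable]: "(\<lambda>z. K (fst z) (snd z)) \<in> borel_measurable (unit_measure \<Otimes>\<^sub>M unit_measure)"
    unfolding K_def by measurable
  have K_bound: "\<bar>K u v\<bar> \<le> 1" for u v
    unfolding K_def
    using cumulative_nonneg[OF w, of "Y0 v - X0 u"] cumulative_le_1[OF w, of "Y0 v - X0 u"]
      cumulative_nonneg[OF w, of "Y1 v - X1 u"] cumulative_le_1[OF w, of "Y1 v - X1 u"]
    by linarith
  have dX: "integrable unit_measure dX" and dY: "integrable unit_measure dY"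
    unfolding dX_def dY_def
    by (intro Bochner_Integration.integrable_diff zero.f.integrable_inv zero.g.integrable_inv
        one.f.integrable_inv one.g.integrable_inv)+
  have [measurable]: "dX \<in> borel_measurable unit_measure" "dY \<in> borel_measurable unit_measure"
    using dX dY by simp_all
  have dX': "integrable (unit_measure \<Otimes>\<^sub>M unit_measure) (\<lambda>z. dX (fst z))"
    using integrable_abs[OF dX] dX by (intro unit_pair.Fubini_integrable) auto
  have dY': "integrable (unit_measure \<Otimes>\<^sub>M unit_measure) (\<lambda>z. dY (snd z))"
    using integrable_abs[OF dY] dY by (intro unit_pair.Fubini_integrable) auto
  have K_mult: "\<bar>K u v * r\<bar> \<le> \<bar>r\<bar>" for u v r
    using K_bound[of u v] by (simp add: abs_mult mult_left_le_one_le)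
  have KX: "integrable (unit_measure \<Otimes>\<^sub>M unit_measure) (\<lambda>(u, v). K u v * dX u)"
    unfolding case_prod_beta'
    by (rule Bochner_Integration.integrable_bound[OF dX']) (measurable, simp add: K_mult)
  have KY: "integrable (unit_measure \<Otimes>\<^sub>M unit_measure) (\<lambda>(u, v). K u v * dY v)"
    unfolding case_prod_beta'
    by (rule Bochner_Integration.integrable_bound[OF dY']) (measurable, simp add: K_mult)
  have K_fst: "(\<integral>u. K u v \<partial>unit_measure) = 0" if "v \<in> {0<..<1}" for v
    unfolding K_def using zero.integral_overlap_fst[OF that] one.integral_overlap_fst[OF that]
    by (simp add: zero.integrable_overlap_fst one.integrable_overlap_fst)
  have K_snd: "(\<integral>v. K u v \<partial>unit_measure) = 0" if "u \<in> {0<..<1}" for u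
    unfolding K_def using zero.conv_at_f_level[OF that] one.conv_at_f_level[OF that]
    by (simp add: zero.integrable_overlap_snd one.integrable_overlap_snd
        zero.integral_overlap_snd one.integral_overlap_snd)
  have "(\<integral>z. (case z of (u, v) \<Rightarrow> K u v * dX u) \<partial>(unit_measure \<Otimes>\<^sub>M unit_measure))
      = (\<integral>u. \<integral>v. K u v * dX u \<partial>unit_measure \<partial>unit_measure)"
    using unit_pair.integral_fst[OF KX] by simp
  also have "\<dots> = (\<integral>u. 0 \<partial>unit_measure)"
    by (rule Bochner_Integration.integral_cong) (simp_all add: K_snd)
  finally have zeroX: "(\<integral>z. (case z of (u, v) \<Rightarrow> K u v * dX u) \<partial>(unit_measure \<Otimes>\<^sub>M unit_measure)) = 0"
    by simp
  have "(\<integral>z. (case z of (u, v) \<Rightarrow> K u v * dY v) \<partial>(unit_measure \<Otimes>\<^sub>M unit_measure))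
      = (\<integral>v. \<integral>u. K u v * dY v \<partial>unit_measure \<partial>unit_measure)"
    using unit_pair.integral_snd[OF KY] by simp
  also have "\<dots> = (\<integral>v. 0 \<partial>unit_measure)"
    by (rule Bochner_Integration.integral_cong) (simp_all add: K_fst)
  finally have zeroY: "(\<integral>z. (case z of (u, v) \<Rightarrow> K u v * dY v) \<partial>(unit_measure \<Otimes>\<^sub>M unit_measure)) = 0"
    by simp
  define \<Phi> where "\<Phi> z = (case z of (u, v) \<Rightarrow> K u v * dY v) - (case z of (u, v) \<Rightarrow> K u v * dX u)" for z
  have \<Phi>_eq: "\<Phi> z = K (fst z) (snd z) * (dY (snd z) - dX (fst z))" for z
    by (simp add: \<Phi>_def case_prod_beta algebra_simps)
  have \<Phi>_nonneg: "0 \<le> \<Phi> z" for z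
  proof -
    obtain u v where z: "z = (u, v)" by (cases z)
    have "0 \<le> (cumulative w s - cumulative w r) * (s - r)" for r s
      using cumulative_mono[OF w, of r s] cumulative_mono[OF w, of s r]
      by (cases "r \<le> s") (auto simp: zero_le_mult_iff)
    from this[of "Y1 v - X1 u" "Y0 v - X0 u"] show ?thesis
      unfolding \<Phi>_eq z by (simp add: K_def dX_def dY_def algebra_simps)
  qed
  have "(\<integral>z. \<Phi> z \<partial>(unit_measure \<Otimes>\<^sub>M unit_measure)) = 0"
    unfolding \<Phi>_def by (subst Bochner_Integration.integral_diff[OF KY KX]) (simp only: zeroX zeroY)
  moreover have "integrable (unit_measure \<Otimes>\<^sub>M unit_measure) \<Phi>"
    unfolding \<Phi>_def by (rule Bochner_Integration.integrable_diff[OF KY KX])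
  ultimately have "AE z in unit_measure \<Otimes>\<^sub>M unit_measure. \<Phi> z = 0"
    using \<Phi>_nonneg by (subst (asm) integral_nonneg_eq_0_iff_AE) auto
  then have "AE z in unit_measure \<Otimes>\<^sub>M unit_measure. one.overlap (fst z) (snd z) = zero.overlap (fst z) (snd z)"
  proof eventually_elim
    case (elim z)
    \<comment> \<open>If \<open>K\<close> were nonzero at a zero of \<open>\<Phi>\<close>, the two
      arguments of \<open>cumulative w\<close> would be equal, and then \<open>K\<close> would
      vanish after all.\<close>
    have "K (fst z) (snd z) = 0"
    proof (rule ccontr)
      assume K: "K (fst z) (snd z) \<noteq> 0"
      with elim have "dY (snd z) = dX (fst z)" by (simp add: \<Phi>_eq)
      then have "Y1 (snd z) - X1 (fst z) = Y0 (snd z) - X0 (fst z)" by (simp add: dX_def dY_def)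
      with K show False by (simp add: K_def)
    qed
    then show ?case by (simp add: K_def)
  qed
  \<comment> \<open>Left continuity removes the exceptional null sets, first in \<open>v\<close> and
    then in \<open>u\<close>.\<close>
  then have "AE u in unit_measure. AE v in unit_measure. one.overlap u v = zero.overlap u v"
    by (auto dest: unit_pair.AE_pair)
  then have "AE u in unit_measure. one.overlap u v = zero.overlap u v"
    by eventually_elim
      (rule AE_unit_eq_imp_eq[OF _ v one.overlap_left_cont(1)[OF v] zero.overlap_left_cont(1)[OF v]])
  then show ?thesis
    by (rule AE_unit_eq_imp_eq[OF _ u one.overlap_left_cont(2)[OF u] zero.overlap_left_cont(2)[OF u]])
qed

text \<open>By \<open>overlap_eq\<close> both waves give the same value, and
  \<open>cumulative w\<close> is injective at values strictly between 0 and 1, so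
  \<open>Y1 v - X1 u\<close> equals \<open>Y0 v - X0 u\<close>.\<close>

lemma shift_eq_of_interaction:
  assumes "regular_window w" and u: "u \<in> {0<..<1}" and v: "v \<in> {0<..<1}"
    and "0 < zero.overlap u v" "zero.overlap u v < 1"
  shows "Y1 v - Y0 v = X1 u - X0 u"
  using cumulative_inj[OF zero.w assms(1,4,5) overlap_eq[OF u v, symmetric]] by simp

lemma shift_left_cont:
  assumes "t \<in> {0<..<1}"
  shows "((\<lambda>v. Y1 v - Y0 v) \<longlongrightarrow> Y1 t - Y0 t) (at_left t)"
  by (intro tendsto_diff one.g.inv_left_cont zero.g.inv_left_cont assms)

text \<open>Suppose the shift of \<open>g\<close> is constant up to the level \<open>t\<close> but no further. Then no level of \<open>f\<close> can
  interact both with \<open>t\<close> and with levels above \<open>t\<close>, so \<open>gap_nonpos\<close> contradicts the positive gap.\<close>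
lemma shift_constant_right:
  assumes reg: "regular_window w" and gap: "strictly_positive_gap hf hg"
    and v: "v \<in> {0<..<1}" and v': "v' \<in> {v..<1}"
  shows "Y1 v' - Y0 v' = Y1 v - Y0 v"
proof (rule ccontr)
  assume neq: "Y1 v' - Y0 v' \<noteq> Y1 v - Y0 v"
  \<comment> \<open>Agreement is required on all of \<open>{v..r}\<close>, so that the levels from
    \<open>v\<close> up to the supremum \<open>t\<close> inherit it and no level above
    \<open>t\<close> belongs to \<open>S\<close>.\<close>
  define S where "S = {r \<in> {v..<1}. \<forall>s \<in> {v..r}. Y1 s - Y0 s = Y1 v - Y0 v}"
  define t where "t = Sup S"
  have "v \<in> S" using v by (auto simp: S_def)
  have bound: "r \<le> v'" if "r \<in> S" for r
  proof (rule ccontr)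
    assume "\<not> r \<le> v'"
    then have "v' \<in> {v..r}" using v' by auto
    with that have "Y1 v' - Y0 v' = Y1 v - Y0 v" unfolding S_def by blast
    with neq show False ..
  qed
  then have bdd: "bdd_above S" by (rule bdd_aboveI)
  have "v \<le> t" unfolding t_def using \<open>v \<in> S\<close> bdd by (rule cSup_upper)
  have "t \<le> v'" unfolding t_def using \<open>v \<in> S\<close> bound by (intro cSup_least) auto
  have t: "t \<in> {0<..<1}" using \<open>v \<le> t\<close> \<open>t \<le> v'\<close> v v' by auto
  have below: "Y1 s - Y0 s = Y1 v - Y0 v" if "v \<le> s" "s < t" for s
  proof -
    obtain r where "r \<in> S" "s < r"
      using \<open>s < t\<close> \<open>v \<in> S\<close> bdd less_cSup_iff[of S s] unfolding t_def by blast
    moreover from this have "s \<in> {v..r}" using \<open>v \<le> s\<close> by auto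
    ultimately show ?thesis unfolding S_def by blast
  qed
  \<comment> \<open>Left continuity carries the constant shift to \<open>t\<close> itself.\<close>
  have at: "Y1 t - Y0 t = Y1 v - Y0 v"
  proof (cases "v = t")
    case False
    with \<open>v \<le> t\<close> have "v < t" by simp
    then have "\<forall>\<^sub>F s in at_left t. v < s \<and> s < t" by (intro eventually_at_leftI[of v]) auto
    then have "\<forall>\<^sub>F s in at_left t. Y1 s - Y0 s = Y1 v - Y0 v"
      by eventually_elim (auto intro: below)
    then have "((\<lambda>s. Y1 s - Y0 s) \<longlongrightarrow> Y1 v - Y0 v) (at_left t)" by (rule tendsto_eventually)
    then show ?thesis using shift_left_cont[OF t] by (intro tendsto_unique[of "at_left t"]) simp_all
  qed simp
  have "gap hf hg t \<le> 0"
  proof (rule zero.gap_nonpos[OF t])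
    fix u s assume u: "u \<in> {0<..<1}" and s: "s \<in> {t<..<1}" and pos: "0 < zero.overlap u t"
    show "zero.overlap u s = 1"
    proof (rule ccontr)
      assume "zero.overlap u s \<noteq> 1"
      then have less: "zero.overlap u s < 1" using cumulative_le_1[OF zero.w] by (simp add: less_le)
      \<comment> \<open>By monotonicity \<open>u\<close> interacts with every level in
        \<open>{t..s}\<close>, so all of these share the shift of \<open>u\<close>; this will put
        \<open>s\<close> into \<open>S\<close>.\<close>
      have interact: "Y1 r - Y0 r = X1 u - X0 u" if "r \<in> {t..s}" for r
      proof (rule shift_eq_of_interaction[OF reg u])
        show "r \<in> {0<..<1}" using that s t by auto
        show "0 < zero.overlap u r" "zero.overlap u r < 1"
          using zero.overlap_mono_snd[of t r u] zero.overlap_mono_snd[of r s u] that s t pos less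
          by auto
      qed
      then have *: "Y1 r - Y0 r = Y1 v - Y0 v" if "r \<in> {t..s}" for r
        using interact[OF that] interact[of t] s at by simp
      have "s \<in> S"
        unfolding S_def
      proof (intro CollectI conjI ballI)
        show "s \<in> {v..<1}" using s \<open>v \<le> t\<close> by auto
        fix r assume "r \<in> {v..s}"
        then show "Y1 r - Y0 r = Y1 v - Y0 v"
          using below[of r] *[of r] by (cases "r < t") simp_all
      qed
      then have "s \<le> t" unfolding t_def using bdd by (intro cSup_upper)
      then show False using s by simp
    qed
  qed
  moreover have "0 < gap hf hg t" using gap t unfolding strictly_positive_gap_def by blast
  ultimately show False by simp
qed

lemma shift_constant:
  assumes "regular_window w" "strictly_positive_gap hf hg"
  shows "\<exists>c. \<forall>v \<in> {0<..<1}. Y1 v = Y0 v + c"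
proof (intro exI ballI)
  fix v :: real assume v: "v \<in> {0<..<1}"
  show "Y1 v = Y0 v + (Y1 (1/2) - Y0 (1/2))"
    using shift_constant_right[OF assms v, of "1/2"] shift_constant_right[OF assms, of "1/2" v] v
    by (cases "v \<le> 1/2") auto
qed

lemma translates:
  assumes "regular_window w" "strictly_positive_gap hf hg"
  shows "\<exists>c. \<forall>x. f1 x = f0 (x - c) \<and> g1 x = g0 (x - c)"
proof -
  obtain c where c: "\<And>v. v \<in> {0<..<1} \<Longrightarrow> Y1 v = Y0 v + c"
    using shift_constant[OF assms] by blast
  have fixed: "g0 x = hg (conv f0 w x)" "f0 x = hf (conv g0 w x)"
    "g1 x = hg (conv f1 w x)" "f1 x = hf (conv g1 w x)" for x
    using zero.fixed one.fixed by (auto simp: fixed_point_def)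
  \<comment> \<open>Only the quantiles of \<open>g\<close> are known to be shifted;
    \<open>f1\<close> follows at every point from its fixed point equation, and then
    \<open>g1\<close> from \<open>f1\<close>.\<close>
  have "conv g1 w x = conv g0 w (x - c)" for x
    by (rule conv_shift[OF zero.g.monotone_profile_axioms one.g.monotone_profile_axioms zero.w c])
  then have f: "f1 x = f0 (x - c)" for x using fixed(2)[of "x - c"] fixed(4)[of x] by simp
  then have "f1 = (\<lambda>x. f0 (x - c))" by auto
  then have "g1 x = g0 (x - c)" for x
    using fixed(1)[of "x - c"] fixed(3)[of x] by (simp add: conv_translate)
  with f show ?thesis by blast
qed

end

section \<open>Right-continuous versions and transport maps\<close>

lemma right_cont_tendsto:
  assumes "mono p"
  shows "(p \<longlongrightarrow> right_cont p x) (at_right x)"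
proof -
  \<comment> \<open>Monotonicity makes the right limit exist, as an infimum, so that
    \<open>Lim\<close> in \<open>right_cont\<close> is meaningful.\<close>
  have "(p \<longlongrightarrow> Inf (p ` ({x<..} \<inter> UNIV))) (at x within ({x<..} \<inter> UNIV))"
    by (rule Lim_right_bound[where K = "p x"]) (simp_all add: monoD[OF assms])
  then have "(p \<longlongrightarrow> Inf (p ` {x<..})) (at_right x)" by simp
  moreover from this have "right_cont p x = Inf (p ` {x<..})"
    unfolding right_cont_def by (intro tendsto_Lim) simp_all
  ultimately show ?thesis by simp
qed

lemma right_cont_le:
  assumes "mono p" "x < y"
  shows "right_cont p x \<le> p y"
proof (rule tendsto_upperbound[OF right_cont_tendsto[OF assms(1)]])
  show "\<forall>\<^sub>F z in at_right x. p z \<le> p y"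
    using assms by (intro eventually_at_rightI[of x y]) (auto intro: monoD)
qed simp

lemma le_right_cont:
  assumes "mono p"
  shows "p x \<le> right_cont p x"
proof (rule tendsto_lowerbound[OF right_cont_tendsto[OF assms]])
  show "\<forall>\<^sub>F z in at_right x. p x \<le> p z"
    using assms by (intro eventually_at_rightI[of x "x + 1"]) (auto intro: monoD)
qed simp

lemma mono_right_cont:
  assumes "mono p"
  shows "mono (right_cont p)"
proof (rule monoI)
  fix x y :: real assume "x \<le> y"
  then show "right_cont p x \<le> right_cont p y"
    using right_cont_le[OF assms, of x y] le_right_cont[OF assms, of y]
    by (cases "x = y") auto
qed

text \<open>Right continuity lets \<open>interval_measure\<close> give \<open>{q<..y}\<close> the
  mass \<open>right_cont p y - right_cont p q\<close>, as \<open>null_flat_right\<close>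
  uses.\<close>

lemma continuous_right_cont:
  assumes "mono p"
  shows "continuous (at_right x) (right_cont p)"
  unfolding continuous_within
proof (rule order_tendstoI)
  fix b assume "b < right_cont p x"
  then have "b < right_cont p y" if "x < y" for y
    using monoD[OF mono_right_cont[OF assms], of x y] that by linarith
  then show "\<forall>\<^sub>F y in at_right x. b < right_cont p y" by (simp add: eventually_at_filter)
next
  fix b assume "right_cont p x < b"
  then have "\<forall>\<^sub>F z in at_right x. p z < b"
    by (rule order_tendstoD(2)[OF right_cont_tendsto[OF assms]])
  then obtain d where d: "x < d" "\<forall>z>x. z < d \<longrightarrow> p z < b"
    unfolding eventually_at_right_field by blast
  obtain z where "x < z" "z < d" using dense[OF d(1)] by blast
  with d have "p z < b" by blast
  then have "right_cont p y < b" if "x < y" "y < z" for y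
    using right_cont_le[OF assms, of y z] that by linarith
  then show "\<forall>\<^sub>F y in at_right x. right_cont p y < b"
    using \<open>x < z\<close> by (intro eventually_at_rightI[of x z]) auto
qed

lemma right_cont_translate:
  assumes "mono p"
  shows "right_cont (\<lambda>x. p (x - c)) x = right_cont p (x - c)"
proof -
  have m: "mono (\<lambda>x. p (x - c))" by (intro monoI monoD[OF assms]) simp
  have "((\<lambda>y. p (y - c)) \<longlongrightarrow> right_cont p (x - c)) (at_right x)"
    using right_cont_tendsto[OF assms, of "x - c"]
    by (subst (asm) filterlim_at_right_to_0, subst filterlim_at_right_to_0) (simp add: algebra_simps)
  then show ?thesis
    using right_cont_tendsto[OF m, of x] by (intro tendsto_unique[of "at_right x"]) simp_all
qed

text \<open>Each \<open>{q<..y}\<close> inside the flat stretch has mass zero. The stretch is one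
  such interval if it has a greatest element, and otherwise a countable union of them with rational
  end points.\<close>

lemma null_flat_right:
  assumes p: "mono p"
  shows "{y. q < y \<and> right_cont p y = right_cont p q} \<in> null_sets (profile_measure p)"
proof -
  let ?r = "right_cont p"
  let ?S = "{y. q < y \<and> ?r y = ?r q}"
  note r_mono = monoD[OF mono_right_cont[OF p]]
  have Ioc: "{q<..y} \<in> null_sets (profile_measure p)" if "y \<in> ?S" for y
    using that emeasure_interval_measure_Ioc[of q y ?r] r_mono continuous_right_cont[OF p]
    by (auto simp: null_sets_def profile_measure_def)
  have down: "y \<in> ?S" if "q < y" "y \<le> z" "z \<in> ?S" for y z
    using that r_mono[of q y] r_mono[of y z] by auto
  show ?thesis
  proof (cases "\<exists>m \<in> ?S. \<forall>y \<in> ?S. y \<le> m")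
    case True
    then obtain m where m: "m \<in> ?S" "\<And>y. y \<in> ?S \<Longrightarrow> y \<le> m" by blast
    then have "?S = {q<..m}" using down by auto
    then show ?thesis using Ioc[OF m(1)] by simp
  next
    case False
    have "?S = (\<Union>z \<in> ?S \<inter> \<rat>. {q<..z})"
    proof (intro equalityI subsetI)
      fix y assume y: "y \<in> ?S"
      with False obtain z where z: "z \<in> ?S" "y < z" by (metis linorder_not_le)
      obtain s where "s \<in> \<rat>" "y < s" "s < z" using Rats_dense_in_real[OF z(2)] by blast
      moreover from this have "s \<in> ?S" using down[of s z] y z by auto
      ultimately show "y \<in> (\<Union>z \<in> ?S \<inter> \<rat>. {q<..z})" using y by (intro UN_I[of s]) auto
    qed (use down in auto)
    moreover have "(\<Union>z \<in> ?S \<inter> \<rat>. {q<..z}) \<in> null_sets (profile_measure p)"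
      by (intro null_sets_UN' Ioc countable_Int2 countable_rat) blast
    ultimately show ?thesis by simp
  qed
qed

text \<open>The infimum defining \<open>transport p q y\<close> is \<open>y + c\<close> unless
  \<open>right_cont p\<close> takes the same value at \<open>y\<close> and at some
  \<open>s < y\<close>. By monotonicity rational \<open>s\<close> suffice, so the exceptional points
  lie in a countable union of null sets.\<close>

lemma AE_transport_translate:
  fixes c :: real
  assumes p: "mono p" "\<And>x. 0 \<le> p x" and q: "\<And>x. q x = p (x - c)"
  shows "AE y in profile_measure p. y - transport p q y = - c"
proof -
  let ?r = "right_cont p"
  note r_mono = monoD[OF mono_right_cont[OF p(1)]]
  let ?N = "\<Union>s \<in> \<rat>. {y. s < y \<and> ?r y = ?r s}"
  have "?N \<in> null_sets (profile_measure p)"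
    by (intro null_sets_UN' null_flat_right p countable_rat)
  then have "AE y in profile_measure p. y \<notin> ?N" by (rule AE_not_in)
  then show ?thesis
  proof eventually_elim
    case (elim y)
    have "q = (\<lambda>x. p (x - c))" using q by auto
    then have rq: "right_cont q x = ?r (x - c)" for x
      using right_cont_translate[OF p(1)] by simp
    have "y + c \<le> x" if "?r y \<le> right_cont q x" for x
    proof (rule ccontr)
      assume "\<not> y + c \<le> x"
      then have "x - c < y" by simp
      then obtain s where s: "s \<in> \<rat>" "x - c < s" "s < y" using Rats_dense_in_real by blast
      then have "?r y = ?r s" using that r_mono[of s y] r_mono[of "x - c" s] by (simp add: rq)
      then show False using elim s by blast
    qed
    then have "Inf {x. ?r y \<le> right_cont q x} = y + c"
      by (intro cInf_eq_minimum) (auto simp: rq)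
    then show ?case by (simp add: transport_def profile_inv_def)
  qed
qed

theorem mainTheorem3:
  fixes w hf hg f0 g0 f1 g1 :: "real \<Rightarrow> real" and \<epsilon> :: real
  assumes "window w" and "regular_window w"
    and "update_fun hf" and "update_fun hg"
    and "strictly_positive_gap hf hg"
    and "0 < \<epsilon>"
    and "f0 \<in> profiles \<epsilon>" and "g0 \<in> profiles \<epsilon>" and "mono f0" and "mono g0"
    and "f1 \<in> profiles \<epsilon>" and "g1 \<in> profiles \<epsilon>" and "mono f1" and "mono g1"
    and "fixed_point hf hg w f0 g0" and "fixed_point hf hg w f1 g1"
  shows "\<exists>c::real. (\<forall>x. f1 x = f0 (x - c) \<and> g1 x = g0 (x - c))
    \<and> (AE y in profile_measure f0. y - transport f0 f1 y = - c)
    \<and> (AE x in profile_measure g0. x - transport g0 g1 x = - c)"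
proof -
  obtain M0 where f0: "monotone_profile f0 (1 / (1 + \<epsilon>)) M0"
    using profiles_monotone_profile[of f0] assms by blast
  obtain N0 where g0: "monotone_profile g0 (1 / (1 + \<epsilon>)) N0"
    using profiles_monotone_profile[of g0] assms by blast
  obtain M1 where f1: "monotone_profile f1 (1 / (1 + \<epsilon>)) M1"
    using profiles_monotone_profile[of f1] assms by blast
  obtain N1 where g1: "monotone_profile g1 (1 / (1 + \<epsilon>)) N1"
    using profiles_monotone_profile[of g1] assms by blast
  interpret two_waves f0 g0 f1 g1 "1 / (1 + \<epsilon>)" "1 / (1 + \<epsilon>)" M0 N0 "1 / (1 + \<epsilon>)" "1 / (1 + \<epsilon>)" M1 N1 w hf hg
    using f0 g0 f1 g1 assms
    by (intro two_waves.intro transition_wave.intro transition_wave_axioms.intro)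
  obtain c where c: "\<And>x. f1 x = f0 (x - c)" "\<And>x. g1 x = g0 (x - c)"
    using translates assms by blast
  moreover have "AE y in profile_measure f0. y - transport f0 f1 y = - c"
    by (rule AE_transport_translate[OF \<open>mono f0\<close> zero.f.nonneg c(1)])
  moreover have "AE x in profile_measure g0. x - transport g0 g1 x = - c"
    by (rule AE_transport_translate[OF \<open>mono g0\<close> zero.g.nonneg c(2)])
  ultimately show ?thesis by blast
qed

end
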